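(* Let $m,n\ge 1$ be integers with $m+n\ge 3$, let $\Theta\in\mathbb{R}^{n\times m}$, and let $\boldsymbol\sigma=(\sigma_1,\ldots,\sigma_m)$, $\boldsymbol\rho=(\rho_1,\ldots,\rho_n)$ be weights: $\sigma_1\ge\ldots\ge\sigma_m>0$, $\rho_1\ge\ldots\ge\rho_n>0$, $\sum_{j=1}^m\sigma_j=\sum_{i=1}^n\rho_i=1$. Set $\omega=\omega_{\boldsymbol\sigma,\boldsymbol\rho}(\Theta)$ and $\omega^\top=\omega_{\boldsymbol\rho,\boldsymbol\sigma}(\Theta^\top)$, where $\Theta^\top$ is the transposed matrix. Then $$\omega^\top\ \ge\ \frac{(\rho_n^{-1}-1)+\sigma_m^{-1}\omega}{\rho_n^{-1}+(\sigma_m^{-1}-1)\omega}.$$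
   Context: For weights $\boldsymbol\sigma\in\mathbb{R}_{>0}^m$, $\boldsymbol\rho\in\mathbb{R}_{>0}^n$ put $|\mathbf x|_{\boldsymbol\sigma}=\max_{1\le j\le m}|x_j|^{1/\sigma_j}$ for $\mathbf x\in\mathbb{R}^m$ and $|\mathbf y|_{\boldsymbol\rho}=\max_{1\le i\le n}|y_i|^{1/\rho_i}$ for $\mathbf y\in\mathbb{R}^n$. For $\Theta\in\mathbb{R}^{n\times m}$ consider the system $$|\mathbf x|_{\boldsymbol\sigma}\le t,\qquad |\Theta\mathbf x-\mathbf y|_{\boldsymbol\rho}\le t^{-\gamma}.\qquad( * )$$ The weighted Diophantine exponent $\omega_{\boldsymbol\sigma,\boldsymbol\rho}(\Theta)\in[1,+\infty]$ is the supremum of real $\gamma$ such that $( * )$ admits nonzero solutions $(\mathbf x,\mathbf y)\in\mathbb{Z}^{m}\times\mathbb{Z}^n$ for some arbitrarily large $t$ (i.e. for every $T$ there is $t\ge T$ for which a nonzero integer solution exists). The exponent $\omega_{\boldsymbol\rho,\boldsymbol\sigma}(\Theta^\top)$ is obtained from the same definition with $(m,n,\boldsymbol\sigma,\boldsymbol\rho,\Theta)$ replaced by $(n,m,\boldsymbol\rho,\boldsymbol\sigma,\Theta^\top)$. If $\omega=+\infty$, the right-hand side is read as its limit as $\omega\to+\infty$, namely $(1-\sigma_m)^{-1}$, with $(1-\sigma_m)^{-1}=+\infty$ when $\sigma_m=1$. *)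

theory Defs
  imports "HOL-Analysis.Analysis"
begin

definition weighted_norm :: "real ^ 'k \<Rightarrow> real ^ 'k \<Rightarrow> real" where
  "weighted_norm w x = Max (range (\<lambda>i. \<bar>x $ i\<bar> powr (1 / w $ i)))"

definition of_int_vec :: "int ^ 'k \<Rightarrow> real ^ 'k" where
  "of_int_vec x = (\<chi> i. of_int (x $ i))"

definition dioph_solution ::
  "real ^ 'm \<Rightarrow> real ^ 'n \<Rightarrow> real ^ 'm ^ 'n \<Rightarrow> real \<Rightarrow> real \<Rightarrow> int ^ 'm \<Rightarrow> int ^ 'n \<Rightarrow> bool" where
  "dioph_solution \<sigma> \<rho> \<Theta> \<gamma> t x y \<longleftrightarrow>
     weighted_norm \<sigma> (of_int_vec x) \<le> t \<and>
     weighted_norm \<rho> (\<Theta> *v of_int_vec x - of_int_vec y) \<le> t powr (- \<gamma>)"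

definition weighted_exponent :: "real ^ 'm \<Rightarrow> real ^ 'n \<Rightarrow> real ^ 'm ^ 'n \<Rightarrow> ereal" where
  "weighted_exponent \<sigma> \<rho> \<Theta> =
     Sup (ereal ` {\<gamma>. \<forall>T. \<exists>t\<ge>T. \<exists>x y. (x, y) \<noteq> (0, 0) \<and> dioph_solution \<sigma> \<rho> \<Theta> \<gamma> t x y})"

(* Here s and r stand for the last (smallest) weights. At infinity the value is the limit of the
   fraction. The exponent is never minus infinity (every \<gamma> \<le> 0 is admissible, with x = 0 and y a
   unit vector), so the value of real_of_ereal there is irrelevant. *)
definition transference_bound :: "real \<Rightarrow> real \<Rightarrow> ereal \<Rightarrow> ereal" where
  "transference_bound s r \<omega> =
     (if \<omega> = \<infinity> then (if s = 1 then \<infinity> else ereal (inverse (1 - s)))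
      else ereal (((inverse r - 1) + inverse s * real_of_ereal \<omega>) /
                  (inverse r + (inverse s - 1) * real_of_ereal \<omega>)))"

end

theory Submission
  imports Defs "HOL-Real_Asymp.Real_Asymp"
begin

text \<open>
  The proof combines a duality principle of Mahler with a choice of exponents.

  Put \<open>d = m + n\<close> and let \<open>\<zeta> = (x, y - \<Theta> x)\<close> for a nonzero integer point \<open>(x, y)\<close>. For an integer point
  \<open>(u, v)\<close> and \<open>w = (\<Theta>\<^sup>T u - v, u)\<close> the \<open>\<Theta>\<close>-terms cancel in the inner product, so
  \<open>\<zeta> \<bullet> w = y \<bullet> u - x \<bullet> v\<close> is an integer. Suppose \<open>\<bar>\<zeta>\<^sub>k\<bar> \<tau>\<^sub>k \<le> \<Prod>\<^sub>i \<tau>\<^sub>i\<close> for every \<open>k\<close>, and choose \<open>k\<close> so that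
  \<open>\<bar>\<zeta>\<^sub>k\<bar> \<tau>\<^sub>k\<close> is largest. Minkowski's theorem on linear forms, applied to the coordinates \<open>w\<^sub>i\<close> with \<open>i \<noteq> k\<close>
  and to \<open>\<zeta> \<bullet> w\<close> (a system of determinant \<open>\<plusminus> \<zeta>\<^sub>k\<close>), gives a nonzero \<open>(u, v)\<close> with \<open>\<bar>w\<^sub>i\<bar> < 2 \<tau>\<^sub>i\<close> for
  \<open>i \<noteq> k\<close> and \<open>\<bar>\<zeta> \<bullet> w\<bar> < 1\<close>. Hence \<open>\<zeta> \<bullet> w = 0\<close>, and this relation bounds the missing coordinate \<open>w\<^sub>k\<close> by
  \<open>2 d \<tau>\<^sub>k\<close> (\<open>mahler_duality\<close>, \<open>box_transference\<close>).

  For the exponents, let \<open>s = \<sigma>\<^sub>m\<close>, \<open>r = \<rho>\<^sub>n\<close>, and let \<open>(x, y)\<close> solve the system with exponent \<open>\<gamma> \<ge> 1\<close> at \<open>t\<close>. The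
  aim is a solution of the transposed system with exponent \<open>\<delta>\<close> at \<open>S = t\<^sup>a\<close>, up to constants, so \<open>\<tau>\<close> consists
  of the numbers \<open>S\<close> to the powers \<open>- \<delta> \<sigma>\<^sub>j\<close> and \<open>\<rho>\<^sub>i\<close>, whose product is \<open>S\<close> to the power \<open>1 - \<delta>\<close>. The duality
  principle applies if
  \<open>a (\<delta> - 1) \<le> (a \<delta> - 1) \<sigma>\<^sub>j\<close> and \<open>a (\<delta> - 1) \<le> (\<gamma> - a) \<rho>\<^sub>i\<close> for all \<open>i\<close>, \<open>j\<close>. The smallest weights are the worst
  case, and equality for them determines \<open>a\<close> and \<open>\<delta>\<close>; this \<open>\<delta>\<close> is the asserted bound at \<open>\<gamma>\<close>
  (\<open>exponent_transference\<close>). Constant factors do not affect exponents (\<open>weighted_exponent_geI\<close>).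

  It remains to let \<open>\<gamma>\<close> tend to \<open>\<omega>\<close> from below. This needs \<open>\<omega> > 1\<close>; both exponents are at least \<open>1\<close> by
  Minkowski's theorem (\<open>weighted_exponent_transpose_ge_1\<close>), and for \<open>\<omega> = 1\<close> the bound equals \<open>1\<close>.
\<close>

section \<open>Minkowski's theorem on linear forms\<close>

lemma of_int_vec_nth [simp]: "of_int_vec x $ i = of_int (x $ i)"
  by (simp add: of_int_vec_def)

text \<open>
  Blichfeldt's theorem. Cut \<open>S\<close> along the integer translates of the half-open unit cube and move all
  pieces back into that cube: if they were disjoint, the measure of \<open>S\<close> would be at most \<open>1\<close>.
\<close>

lemma blichfeldt:
  fixes S :: "(real ^ 'd) set"
  assumes S: "S \<in> sets lebesgue" and vol: "emeasure lebesgue S > 1"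
  obtains x y p where "x \<in> S" "y \<in> S" "p \<noteq> 0" "x - y = of_int_vec p"
proof -
  define Q :: "(real ^ 'd) set" where "Q = {x. \<forall>i. 0 \<le> x $ i \<and> x $ i < 1}"
  define piece where "piece p = S \<inter> (+) (of_int_vec p) ` Q" for p :: "int ^ 'd"
  have Q: "Q \<in> sets lebesgue"
  proof -
    have "Q \<in> sets borel"
      unfolding Q_def by measurable
    then show ?thesis by simp
  qed
  have in_piece: "x \<in> (+) (of_int_vec p) ` Q \<longleftrightarrow> p = (\<chi> i. \<lfloor>x $ i\<rfloor>)" for x p
  proof -
    have "x \<in> (+) (of_int_vec p) ` Q \<longleftrightarrow> x - of_int_vec p \<in> Q"
      by (auto simp: image_iff algebra_simps intro!: bexI[of _ "x - of_int_vec p"])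
    also have "\<dots> \<longleftrightarrow> (\<forall>i. \<lfloor>x $ i\<rfloor> = p $ i)"
      unfolding Q_def by (auto simp: floor_eq_iff algebra_simps)
    finally show ?thesis by (auto simp: vec_eq_iff)
  qed
  have piece_sets: "piece p \<in> sets lebesgue" for p
    unfolding piece_def using S Q lebesgue_sets_translation by blast
  have emeasure_shift: "emeasure lebesgue ((+) a ` X) = emeasure lebesgue X" for a and X :: "(real ^ 'd) set"
    using emeasure_lebesgue_affine[of 1 a X] by (simp add: ac_simps cong: image_cong_simp)
  let ?back = "\<lambda>p. (+) (- of_int_vec p) ` piece p"
  have "\<exists>p q. p \<noteq> q \<and> ?back p \<inter> ?back q \<noteq> {}"
  proof (rule ccontr)
    assume "\<not> ?thesis"
    then have disj: "disjoint_family ?back"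
      by (auto simp: disjoint_family_on_def)
    have piece_disj: "disjoint_family piece"
    proof -
      have "x \<in> piece p \<Longrightarrow> p = (\<chi> i. \<lfloor>x $ i\<rfloor>)" for x p
        using in_piece by (simp add: piece_def)
      then show ?thesis
        unfolding disjoint_family_on_def by (metis disjoint_iff)
    qed
    have "S = (\<Union>p. piece p)"
      by (auto simp: piece_def in_piece)
    then have "emeasure lebesgue S = (\<integral>\<^sup>+p. emeasure lebesgue (piece p) \<partial>count_space UNIV)"
      using emeasure_UN_countable[of UNIV piece lebesgue, OF piece_sets _ piece_disj] by simp
    also have "\<dots> = (\<integral>\<^sup>+p. emeasure lebesgue (?back p) \<partial>count_space UNIV)"
      by (simp only: emeasure_shift)
    also have "\<dots> = emeasure lebesgue (\<Union>p. ?back p)"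
      by (rule emeasure_UN_countable[symmetric])
         (use piece_sets disj lebesgue_sets_translation in blast)+
    also have "\<dots> \<le> emeasure lebesgue (cbox 0 1 :: (real ^ 'd) set)"
      by (intro emeasure_mono) (auto simp: piece_def Q_def mem_box_cart less_imp_le)
    also have "\<dots> = 1"
    proof -
      have "measure lborel (cbox 0 1 :: (real ^ 'd) set) = 1"
        by (simp add: content_cbox_if_cart interval_eq_empty_cart not_less)
      then show ?thesis
        by (simp add: emeasure_eq_ennreal_measure emeasure_lborel_cbox_eq)
    qed
    finally show False using vol by simp
  qed
  then obtain p q x y where "p \<noteq> q" "x \<in> piece p" "y \<in> piece q" "x - of_int_vec p = y - of_int_vec q"
    by fastforce
  then show thesis
    by (intro that[of x y "p - q"]) (auto simp: piece_def vec_eq_iff algebra_simps)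
qed

text \<open>
  The two points that Blichfeldt's theorem finds in the parallelepiped
  \<open>\<bar>(A x)\<^sub>i\<bar> < b\<^sub>i / 2\<close> have the required integer point as their difference. The index type is
  well-ordered because the formula for the volume of a linear image asks for it.
\<close>

lemma minkowski_linear_forms:
  fixes A :: "real ^ 'd::{finite,wellorder} ^ 'd::_"
  assumes "det A \<noteq> 0" and b: "\<And>i. b i > 0" and vol: "\<bar>det A\<bar> < (\<Prod>i\<in>UNIV. b i)"
  obtains p where "p \<noteq> 0" "\<And>i. \<bar>(A *v of_int_vec p) $ i\<bar> < b i"
proof -
  obtain A' where A': "A ** A' = mat 1" "A' ** A = mat 1"
    using \<open>det A \<noteq> 0\<close> by (meson invertible_def invertible_det_nz)
  define B :: "(real ^ 'd::_) set" where "B = box (\<chi> i. - (b i / 2)) (\<chi> i. b i / 2)"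
  have B: "B \<in> lmeasurable" by (simp add: B_def)
  have B_vol: "measure lebesgue B = (\<Prod>i\<in>UNIV. b i)"
  proof -
    have "measure lebesgue B = measure lborel (cbox (\<chi> i. - (b i / 2)) (\<chi> i. b i / 2) :: (real ^ 'd::_) set)"
      by (simp add: B_def measure_lborel_box_eq measure_lborel_cbox_eq)
    also have "\<dots> = (\<Prod>i\<in>UNIV. b i)"
      using b by (simp add: content_cbox_if_cart interval_eq_empty_cart less_imp_le not_less)
         (meson linorder_not_less less_imp_le)
    finally show ?thesis .
  qed
  define S where "S = (*v) A' ` B"
  have S: "S \<in> lmeasurable"
    unfolding S_def by (intro measurable_linear_image B) auto
  have "det A * det A' = 1"
    using A'(1) by (metis det_I det_mul)
  then have "\<bar>det A\<bar> * \<bar>det A'\<bar> = 1"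
    by (metis abs_mult abs_one)
  moreover have "measure lebesgue S = \<bar>det A'\<bar> * (\<Prod>i\<in>UNIV. b i)"
    unfolding S_def using measure_linear_image[OF _ B, of "(*v) A'"] B_vol by simp
  ultimately have "measure lebesgue S > 1"
    using vol by (smt (verit) mult_less_cancel_left mult.commute mult_not_zero abs_ge_zero)
  then have "emeasure lebesgue S > 1"
    using S by (simp add: emeasure_eq_measure2)
  then obtain x y p where xy: "x \<in> S" "y \<in> S" "p \<noteq> 0" "x - y = of_int_vec p"
    using blichfeldt[of S] S by blast
  then obtain x' y' where B': "x' \<in> B" "y' \<in> B" "x = A' *v x'" "y = A' *v y'"
    unfolding S_def by auto
  have "A *v of_int_vec p = x' - y'"
    using xy(4) B'(3,4) A'(1)
    by (metis matrix_vector_mul_assoc matrix_vector_mul_lid matrix_vector_mult_diff_distrib)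
  then have "\<bar>(A *v of_int_vec p) $ i\<bar> < b i" for i
    using B'(1,2)[unfolded B_def mem_box_cart, THEN spec, of i] by (simp add: abs_less_iff)
  with xy(3) show thesis using that by blast
qed

section \<open>Mahler's duality principle\<close>

text \<open>
  Here \<open>W\<close> maps the integer points onto a lattice of covolume \<open>1\<close>, and \<open>\<zeta>\<close> is a nonzero point of the
  dual lattice. A point \<open>\<zeta>\<close> in the box with sides proportional to \<open>(\<Prod>\<^sub>i \<tau>\<^sub>i) / \<tau>\<^sub>k\<close> forces a nonzero lattice
  point into the box with sides proportional to \<open>\<tau>\<^sub>k\<close>.
\<close>

lemma mahler_duality:
  fixes W :: "real ^ 'd::{finite,wellorder} ^ 'd::_" and \<zeta> :: "real ^ 'd::_" and \<tau> :: "'d::_ \<Rightarrow> real"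
  assumes W: "\<bar>det W\<bar> = 1" and d: "CARD('d) \<ge> 2" and "\<zeta> \<noteq> 0"
    and int: "\<And>p. \<zeta> \<bullet> (W *v of_int_vec p) \<in> \<int>"
    and \<tau>: "\<And>i. \<tau> i > 0" and \<zeta>: "\<And>k. \<bar>\<zeta> $ k\<bar> * \<tau> k \<le> (\<Prod>i\<in>UNIV. \<tau> i)"
  obtains p where "p \<noteq> 0" "\<And>i. \<bar>(W *v of_int_vec p) $ i\<bar> \<le> 2 * CARD('d) * \<tau> i"
proof -
  define f where "f i = \<bar>\<zeta> $ i\<bar> * \<tau> i" for i
  have "Max (range f) \<in> range f"
    by (rule Max_in) auto
  then obtain k where "Max (range f) = f k"
    by (rule imageE)
  then have "f i \<le> f k" for i
    by (metis Max_ge finite finite_imageI rangeI)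
  then have k: "\<bar>\<zeta> $ i\<bar> * \<tau> i \<le> \<bar>\<zeta> $ k\<bar> * \<tau> k" for i
    by (simp add: f_def)
  have pos: "\<bar>\<zeta> $ k\<bar> > 0"
  proof (rule ccontr)
    assume "\<not> ?thesis"
    then have "\<bar>\<zeta> $ i\<bar> * \<tau> i \<le> 0" for i
      using k[of i] by simp
    then have "\<zeta> $ i = 0" for i
      using \<tau>[of i] by (auto simp: mult_le_0_iff not_le[symmetric])
    with \<open>\<zeta> \<noteq> 0\<close> show False by (simp add: vec_eq_iff)
  qed
  \<comment> \<open>The identity matrix with row \<open>k\<close> replaced by \<open>\<zeta>\<close>; Cramer's rule gives its determinant.\<close>
  define R :: "real ^ 'd::_ ^ 'd::_" where "R = (\<chi> i. if i = k then \<zeta> else axis i 1)"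
  have "R = (\<chi> i. if i = k then sum (\<lambda>i. \<zeta> $ i *s row i (mat 1)) UNIV else row i (mat 1))"
  proof -
    have "sum (\<lambda>i. \<zeta> $ i *s row i (mat 1)) UNIV = \<zeta>"
      by (simp add: vec_eq_iff row_def mat_def if_distrib cong: if_cong)
    moreover have "row i (mat 1) = axis i (1::real)" for i :: "'d::_"
      by (auto simp: vec_eq_iff row_def mat_def axis_def)
    ultimately show ?thesis by (simp add: R_def cong: if_cong)
  qed
  then have "det R = \<zeta> $ k"
    using cramer_lemma_transpose[of k \<zeta> "mat 1"] by simp
  then have det: "\<bar>det (R ** W)\<bar> = \<bar>\<zeta> $ k\<bar>"
    using W by (simp add: det_mul abs_mult)
  have R_apply: "(R *v w) $ i = (if i = k then \<zeta> \<bullet> w else w $ i)" for w i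
    by (simp add: matrix_vector_mul_component R_def inner_axis')
  define b where "b i = (if i = k then 1 else 2 * \<tau> i)" for i
  have "\<bar>\<zeta> $ k\<bar> \<le> (\<Prod>i\<in>UNIV - {k}. \<tau> i)"
    using \<zeta>[of k] \<tau>[of k] prod.remove[of UNIV k \<tau>] by (simp add: mult.commute)
  \<comment> \<open>The factor \<open>2\<close> makes the inequality strict, as there is at least one index other than \<open>k\<close>.\<close>
  also have "\<dots> < 2 ^ (CARD('d) - 1) * \<dots>"
    using d \<tau> by (simp add: prod_pos)
  also have "\<dots> = (\<Prod>i\<in>UNIV - {k}. 2 * \<tau> i)"
    by (simp add: prod.distrib)
  also have "\<dots> = (\<Prod>i\<in>UNIV. b i)"
    by (subst prod.remove[of UNIV k b]) (auto simp: b_def intro!: prod.cong)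
  finally have vol: "\<bar>det (R ** W)\<bar> < (\<Prod>i\<in>UNIV. b i)"
    using det by simp
  have "det (R ** W) \<noteq> 0" "\<And>i. b i > 0"
    using det pos \<tau> by (auto simp: b_def)
  from minkowski_linear_forms[OF this vol] obtain p where
    p: "p \<noteq> 0" "\<And>i. \<bar>((R ** W) *v of_int_vec p) $ i\<bar> < b i"
    by blast
  define w where "w = W *v of_int_vec p"
  have w: "\<bar>if i = k then \<zeta> \<bullet> w else w $ i\<bar> < b i" for i
    using p(2)[of i] unfolding matrix_vector_mul_assoc[symmetric] R_apply w_def .
  then have w_le: "\<bar>w $ i\<bar> \<le> 2 * \<tau> i" if "i \<noteq> k" for i
    using that w[of i] by (simp add: b_def)
  have "\<bar>\<zeta> \<bullet> w\<bar> < 1"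
    using w[of k] by (simp add: b_def)
  moreover have "\<zeta> \<bullet> w \<in> \<int>"
    unfolding w_def by (rule int)
  ultimately have "\<zeta> \<bullet> w = 0"
    using Ints_nonzero_abs_less1 by blast
  then have "\<zeta> $ k * w $ k = - (\<Sum>i\<in>UNIV - {k}. \<zeta> $ i * w $ i)"
    by (simp add: inner_vec_def sum.remove[of UNIV k])
  then have "\<bar>\<zeta> $ k\<bar> * \<bar>w $ k\<bar> = \<bar>\<Sum>i\<in>UNIV - {k}. \<zeta> $ i * w $ i\<bar>"
    by (simp only: abs_mult[symmetric] abs_minus_cancel)
  also have "\<dots> \<le> (\<Sum>i\<in>UNIV - {k}. \<bar>\<zeta> $ i * w $ i\<bar>)"
    by (rule sum_abs)
  also have "\<dots> \<le> (\<Sum>i\<in>UNIV - {k}. 2 * (\<bar>\<zeta> $ k\<bar> * \<tau> k))"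
  proof (rule sum_mono)
    fix i assume "i \<in> UNIV - {k}"
    then have "\<bar>\<zeta> $ i * w $ i\<bar> \<le> \<bar>\<zeta> $ i\<bar> * (2 * \<tau> i)"
      unfolding abs_mult by (intro mult_left_mono w_le) auto
    with k[of i] show "\<bar>\<zeta> $ i * w $ i\<bar> \<le> 2 * (\<bar>\<zeta> $ k\<bar> * \<tau> k)"
      by simp
  qed
  also have "\<dots> \<le> \<bar>\<zeta> $ k\<bar> * (2 * CARD('d) * \<tau> k)"
    using pos \<tau>[of k] by (simp add: mult_le_cancel_right)
  finally have "\<bar>w $ k\<bar> \<le> 2 * CARD('d) * \<tau> k"
    using pos by simp
  moreover have "2 * \<tau> i \<le> 2 * CARD('d) * \<tau> i" for i
    using \<tau>[of i] d by (simp add: mult_le_cancel_right)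
  ultimately have "\<bar>w $ i\<bar> \<le> 2 * CARD('d) * \<tau> i" for i
    using order_trans[OF w_le] by (cases "i = k") blast+
  with p(1) show thesis
    using that unfolding w_def by blast
qed

section \<open>The linear forms of the transposed system\<close>

text \<open>
  The \<open>m + n\<close> linear forms are indexed by a sum type. It is given an arbitrary well-order, merely so
  that \<open>minkowski_linear_forms\<close> applies; the choice of the order is irrelevant.
\<close>

definition sum_wellorder :: "('a + 'b) rel" where
  "sum_wellorder = (SOME r. well_order_on UNIV r)"

lemma well_order_sum_wellorder: "well_order_on UNIV sum_wellorder"
  unfolding sum_wellorder_def by (rule someI_ex) (rule well_order_on)

instantiation sum :: (type, type) wellorder
begin

definition less_eq_sum :: "'a + 'b \<Rightarrow> 'a + 'b \<Rightarrow> bool" where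
  "less_eq_sum x y \<longleftrightarrow> (x, y) \<in> sum_wellorder"

definition less_sum :: "'a + 'b \<Rightarrow> 'a + 'b \<Rightarrow> bool" where
  "less_sum x y \<longleftrightarrow> x \<noteq> y \<and> (x, y) \<in> sum_wellorder"

instance
proof
  let ?R = "sum_wellorder :: ('a + 'b) rel"
  have wo: "refl ?R" "trans ?R" "antisym ?R" "total ?R" "wf (?R - Id)"
    using well_order_sum_wellorder[where 'a='a and 'b='b] unfolding order_on_defs by blast+
  fix x y z :: "'a + 'b" and P :: "'a + 'b \<Rightarrow> bool" and a :: "'a + 'b"
  have anti: "x = y" if "(x, y) \<in> ?R" "(y, x) \<in> ?R" for x y
    using wo(3) that by (rule antisymD)
  have refl: "(x, x) \<in> ?R" for x
    using wo(1) by (rule reflD)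
  have total: "x = y \<or> (x, y) \<in> ?R \<or> (y, x) \<in> ?R" for x y
    using wo(4) unfolding total_on_def by blast
  show "x < y \<longleftrightarrow> x \<le> y \<and> \<not> y \<le> x"
    unfolding less_eq_sum_def less_sum_def using anti[of x y] refl[of x] by (cases "x = y") blast+
  show "x \<le> x"
    unfolding less_eq_sum_def by (rule refl)
  show "x \<le> z" if "x \<le> y" "y \<le> z"
    using wo(2) that unfolding less_eq_sum_def by (rule transD)
  show "x = y" if "x \<le> y" "y \<le> x"
    using that unfolding less_eq_sum_def by (rule anti)
  show "x \<le> y \<or> y \<le> x"
    unfolding less_eq_sum_def using total[of x y] refl[of x] by blast
  show "P a" if step: "\<And>x. (\<And>y. y < x \<Longrightarrow> P y) \<Longrightarrow> P x"
  proof (rule wf_induct_rule[OF wo(5)])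
    fix x assume "\<And>y. (y, x) \<in> ?R - Id \<Longrightarrow> P y"
    then show "P x"
      by (rule step) (simp add: less_sum_def)
  qed
qed

end

lemma sum_UNIV_Plus:
  fixes f :: "'m::finite + 'n::finite \<Rightarrow> 'a::comm_monoid_add"
  shows "(\<Sum>k\<in>UNIV. f k) = (\<Sum>j\<in>UNIV. f (Inl j)) + (\<Sum>i\<in>UNIV. f (Inr i))"
  by (simp add: sum.Plus flip: UNIV_Plus_UNIV)

lemma prod_UNIV_Plus:
  fixes f :: "'m::finite + 'n::finite \<Rightarrow> 'a::comm_monoid_mult"
  shows "(\<Prod>k\<in>UNIV. f k) = (\<Prod>j\<in>UNIV. f (Inl j)) * (\<Prod>i\<in>UNIV. f (Inr i))"
  by (simp add: prod.Plus flip: UNIV_Plus_UNIV)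

text \<open>
  The matrix of the map \<open>(v, u) \<mapsto> (\<Theta>\<^sup>T u - v, u)\<close>. The left summand of the index type carries \<open>v\<close>, the
  right one carries \<open>u\<close>.
\<close>

definition transposed_forms :: "real ^ 'm ^ 'n \<Rightarrow> real ^ ('m + 'n) ^ ('m + 'n)" where
  "transposed_forms \<Theta> = (\<chi> a b.
     case (a, b) of
       (Inl j, Inl j') \<Rightarrow> if j' = j then - 1 else 0
     | (Inl j, Inr i) \<Rightarrow> \<Theta> $ i $ j
     | (Inr i, Inl j) \<Rightarrow> 0
     | (Inr i, Inr i') \<Rightarrow> if i' = i then 1 else 0)"

lemma transposed_forms_Inl:
  "(transposed_forms \<Theta> *v p) $ Inl j = (transpose \<Theta> *v (\<chi> i. p $ Inr i)) $ j - p $ Inl j"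
  by (simp add: transposed_forms_def matrix_vector_mult_def sum_UNIV_Plus transpose_def if_distrib if_distribR
        cong: if_cong)

lemma transposed_forms_Inr: "(transposed_forms \<Theta> *v p) $ Inr i = p $ Inr i"
  by (simp add: transposed_forms_def matrix_vector_mult_def sum_UNIV_Plus if_distrib if_distribR cong: if_cong)

text \<open>The map is an involution, so the square of its determinant is \<open>1\<close>.\<close>

lemma abs_det_transposed_forms: "\<bar>det (transposed_forms \<Theta>)\<bar> = 1"
proof -
  have "(transposed_forms \<Theta> *v (transposed_forms \<Theta> *v p)) $ k = p $ k" for p k
    by (cases k) (simp_all add: transposed_forms_Inl transposed_forms_Inr)
  then have "transposed_forms \<Theta> ** transposed_forms \<Theta> = mat 1"
    by (simp add: matrix_eq vec_eq_iff flip: matrix_vector_mul_assoc)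
  then have "det (transposed_forms \<Theta>) * det (transposed_forms \<Theta>) = 1"
    by (metis det_I det_mul)
  then show ?thesis
    by (metis abs_mult abs_one abs_mult_self_eq mult_cancel_right1 power2_eq_square abs_square_eq_1)
qed

text \<open>
  With \<open>\<zeta> = (x, y - \<Theta> x)\<close> the terms containing \<open>\<Theta>\<close> cancel and the pairing is \<open>y \<bullet> u - x \<bullet> v\<close>.
\<close>

lemma transposed_forms_integer_pairing:
  fixes \<Theta> :: "real ^ 'm ^ 'n"
  defines "\<zeta> x y \<equiv> (\<chi> k. case k of Inl j \<Rightarrow> of_int_vec x $ j | Inr i \<Rightarrow> (of_int_vec y - \<Theta> *v of_int_vec x) $ i)"
  shows "\<zeta> x y \<bullet> (transposed_forms \<Theta> *v of_int_vec p) \<in> \<int>"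
proof -
  define u :: "int ^ 'n" where "u = (\<chi> i. p $ Inr i)"
  define v :: "int ^ 'm" where "v = (\<chi> j. p $ Inl j)"
  let ?x = "of_int_vec x" and ?y = "of_int_vec y" and ?u = "of_int_vec u" and ?v = "of_int_vec v"
  have "\<zeta> x y \<bullet> (transposed_forms \<Theta> *v of_int_vec p) = ?x \<bullet> (transpose \<Theta> *v ?u - ?v) + (?y - \<Theta> *v ?x) \<bullet> ?u"
  proof -
    have "(\<chi> i. of_int_vec p $ Inr i) = ?u"
      by (simp add: vec_eq_iff u_def)
    then show ?thesis
      by (simp add: \<zeta>_def inner_vec_def sum_UNIV_Plus transposed_forms_Inl transposed_forms_Inr v_def u_def)
  qed
  also have "\<dots> = ?y \<bullet> ?u - ?x \<bullet> ?v"
    by (simp add: inner_diff_left inner_diff_right dot_lmul_matrix transpose_matrix_vector inner_commute)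
       (metis dot_lmul_matrix inner_commute)
  also have "\<dots> \<in> \<int>"
    by (auto simp: inner_vec_def intro!: Ints_diff Ints_sum Ints_mult)
  finally show ?thesis .
qed

lemma transposed_forms_solution:
  fixes \<Theta> :: "real ^ 'm ^ 'n" and p :: "int ^ ('m + 'n)"
  assumes "p \<noteq> 0" and bound: "\<And>k. \<bar>(transposed_forms \<Theta> *v of_int_vec p) $ k\<bar> \<le> b k"
  shows "\<exists>u v. (u, v) \<noteq> (0, 0) \<and> (\<forall>i. \<bar>of_int (u $ i)\<bar> \<le> b (Inr i)) \<and>
    (\<forall>j. \<bar>(transpose \<Theta> *v of_int_vec u) $ j - of_int (v $ j)\<bar> \<le> b (Inl j))"
proof (intro exI conjI allI)
  let ?u = "\<chi> i. p $ Inr i" and ?v = "\<chi> j. p $ Inl j"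
  show "(?u, ?v) \<noteq> (0, 0)"
  proof
    assume "(?u, ?v) = (0, 0)"
    then have "p $ k = 0" for k
      by (cases k) (simp_all add: vec_eq_iff)
    with \<open>p \<noteq> 0\<close> show False by (simp add: vec_eq_iff)
  qed
  show "\<bar>of_int (?u $ i)\<bar> \<le> b (Inr i)" for i
    using bound[of "Inr i"] by (simp add: transposed_forms_Inr)
  have "(\<chi> i. of_int_vec p $ Inr i) = of_int_vec ?u"
    by (simp add: vec_eq_iff)
  then show "\<bar>(transpose \<Theta> *v of_int_vec ?u) $ j - of_int (?v $ j)\<bar> \<le> b (Inl j)" for j
    using bound[of "Inl j"] by (simp add: transposed_forms_Inl)
qed

section \<open>Weighted exponents\<close>

lemma weighted_norm_le_powr_iff:
  fixes w x :: "real ^ 'k"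
  assumes w: "\<forall>i. w $ i > 0" and t: "t > 0"
  shows "weighted_norm w x \<le> t powr a \<longleftrightarrow> (\<forall>i. \<bar>x $ i\<bar> \<le> t powr (a * w $ i))"
proof -
  have "\<bar>x $ i\<bar> powr (1 / w $ i) \<le> t powr a \<longleftrightarrow> \<bar>x $ i\<bar> \<le> t powr (a * w $ i)" for i
  proof -
    have wi: "w $ i > 0" using w by simp
    have "\<bar>x $ i\<bar> powr (1 / w $ i) \<le> t powr a \<longleftrightarrow>
        (\<bar>x $ i\<bar> powr (1 / w $ i)) powr (w $ i) \<le> (t powr a) powr (w $ i)"
      using wi by (meson powr_ge_zero powr_less_mono2 powr_mono2 less_imp_le not_less)
    also have "\<dots> \<longleftrightarrow> \<bar>x $ i\<bar> \<le> t powr (a * w $ i)"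
      using wi by (simp add: powr_powr)
    finally show ?thesis .
  qed
  then show ?thesis
    by (simp add: weighted_norm_def)
qed

lemma dioph_solution_iff:
  assumes "\<forall>j. \<sigma> $ j > 0" "\<forall>i. \<rho> $ i > 0" "t > 0"
  shows "dioph_solution \<sigma> \<rho> \<Theta> \<gamma> t x y \<longleftrightarrow>
    (\<forall>j. \<bar>of_int (x $ j)\<bar> \<le> t powr (\<sigma> $ j)) \<and>
    (\<forall>i. \<bar>(\<Theta> *v of_int_vec x) $ i - of_int (y $ i)\<bar> \<le> t powr (- \<gamma> * \<rho> $ i))"
  using weighted_norm_le_powr_iff[OF assms(1,3), of "of_int_vec x" 1]
    weighted_norm_le_powr_iff[OF assms(2,3), of "\<Theta> *v of_int_vec x - of_int_vec y" "- \<gamma>"] assms(3)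
  by (simp add: dioph_solution_def)

lemma dioph_solution_antimono:
  assumes "\<gamma> \<le> \<gamma>'" "t \<ge> 1" "dioph_solution \<sigma> \<rho> \<Theta> \<gamma>' t x y"
  shows "dioph_solution \<sigma> \<rho> \<Theta> \<gamma> t x y"
proof -
  have "t powr (- \<gamma>') \<le> t powr (- \<gamma>)"
    using assms(1,2) by (intro powr_mono) simp_all
  with assms(3) show ?thesis
    unfolding dioph_solution_def by (meson order_trans)
qed

lemma solutions_below_weighted_exponent:
  assumes "ereal \<gamma> < weighted_exponent \<sigma> \<rho> \<Theta>"
  shows "\<exists>t\<ge>T. \<exists>x y. (x, y) \<noteq> (0, 0) \<and> dioph_solution \<sigma> \<rho> \<Theta> \<gamma> t x y"
proof -
  obtain \<gamma>' where "\<gamma> < \<gamma>'"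
    "\<And>T. \<exists>t\<ge>T. \<exists>x y. (x, y) \<noteq> (0, 0) \<and> dioph_solution \<sigma> \<rho> \<Theta> \<gamma>' t x y"
    using assms unfolding weighted_exponent_def less_Sup_iff by auto
  then obtain t x y where "t \<ge> max 1 T" "(x, y) \<noteq> (0, 0)" "dioph_solution \<sigma> \<rho> \<Theta> \<gamma>' t x y"
    by blast
  moreover have "dioph_solution \<sigma> \<rho> \<Theta> \<gamma> t x y"
    using calculation \<open>\<gamma> < \<gamma>'\<close> by (intro dioph_solution_antimono[of \<gamma> \<gamma>']) simp_all
  moreover have "T \<le> t"
    using calculation(1) by simp
  ultimately show ?thesis by blast
qed

lemma filterlim_powr_at_top:
  fixes a :: real
  assumes "a > 0"
  shows "filterlim (\<lambda>x. x powr a) at_top at_top"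
  unfolding filterlim_at_top
proof
  fix Z :: real
  show "\<forall>\<^sub>F x in at_top. Z \<le> x powr a"
    using eventually_ge_at_top[of "max Z 1 powr (1 / a)"]
  proof eventually_elim
    case (elim x)
    then have "(max Z 1 powr (1 / a)) powr a \<le> x powr a"
      using assms by (intro powr_mono2) auto
    then show ?case
      using assms by (simp add: powr_powr)
  qed
qed

text \<open>
  A constant factor \<open>C\<close> in both inequalities does not matter: replacing \<open>s\<close> by \<open>K s\<close> with a large constant
  \<open>K\<close> absorbs it in the first inequality, and lowering the exponent \<open>\<delta>\<close> slightly absorbs it, for large
  \<open>s\<close>, in the second.
\<close>

lemma weighted_exponent_geI:
  fixes \<sigma> :: "real ^ 'm" and \<rho> :: "real ^ 'n" and \<Theta> :: "real ^ 'm ^ 'n"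
  assumes \<sigma>: "\<forall>j. \<sigma> $ j > 0" and \<rho>: "\<forall>i. \<rho> $ i > 0" and C: "C > 0"
    and sol: "\<And>T. \<exists>s\<ge>T. \<exists>x y. (x, y) \<noteq> (0, 0) \<and>
      (\<forall>j. \<bar>of_int (x $ j)\<bar> \<le> C * s powr (\<sigma> $ j)) \<and>
      (\<forall>i. \<bar>(\<Theta> *v of_int_vec x) $ i - of_int (y $ i)\<bar> \<le> C * s powr (- \<delta> * \<rho> $ i))"
  shows "ereal \<delta> \<le> weighted_exponent \<sigma> \<rho> \<Theta>"
proof -
  have "ereal \<delta>' \<le> weighted_exponent \<sigma> \<rho> \<Theta>" if "\<delta>' < \<delta>" for \<delta>'
  proof -
    define K where "K = 1 + (\<Sum>j\<in>UNIV. C powr (1 / \<sigma> $ j))"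
    have "K \<ge> 1"
      unfolding K_def by (simp add: sum_nonneg)
    have K: "C \<le> K powr (\<sigma> $ j)" for j
    proof -
      have "C powr (1 / \<sigma> $ j) \<le> (\<Sum>j\<in>UNIV. C powr (1 / \<sigma> $ j))"
        by (rule member_le_sum) auto
      then have "(C powr (1 / \<sigma> $ j)) powr (\<sigma> $ j) \<le> K powr (\<sigma> $ j)"
        using \<sigma> by (intro powr_mono2) (auto simp: K_def less_imp_le)
      then show ?thesis
        using C \<sigma>[THEN spec, of j] by (simp add: powr_powr)
    qed
    have "\<forall>\<^sub>F s in at_top. C * s powr (- \<delta> * \<rho> $ i) \<le> (K * s) powr (- \<delta>' * \<rho> $ i)" for i
    proof -
      have "(\<delta> - \<delta>') * \<rho> $ i > 0"
        using that \<rho> by simp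
      then have "filterlim (\<lambda>s. s powr ((\<delta> - \<delta>') * \<rho> $ i)) at_top at_top"
        by (rule filterlim_powr_at_top)
      then have "\<forall>\<^sub>F s in at_top. C / K powr (- \<delta>' * \<rho> $ i) \<le> s powr ((\<delta> - \<delta>') * \<rho> $ i)"
        by (simp add: filterlim_at_top)
      then show ?thesis
        using eventually_gt_at_top[of 0]
      proof eventually_elim
        case (elim s)
        then have "C \<le> K powr (- \<delta>' * \<rho> $ i) * s powr ((\<delta> - \<delta>') * \<rho> $ i)"
          using \<open>K \<ge> 1\<close> by (simp add: divide_le_eq mult.commute split: if_splits)
        then have "C * s powr (- \<delta> * \<rho> $ i) \<le>
            K powr (- \<delta>' * \<rho> $ i) * s powr ((\<delta> - \<delta>') * \<rho> $ i) * s powr (- \<delta> * \<rho> $ i)"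
          by (rule mult_right_mono) simp
        also have "\<dots> = K powr (- \<delta>' * \<rho> $ i) * s powr (- \<delta>' * \<rho> $ i)"
          by (simp add: powr_add[symmetric] algebra_simps)
        also have "\<dots> = (K * s) powr (- \<delta>' * \<rho> $ i)"
          using \<open>K \<ge> 1\<close> elim(2) by (simp add: powr_mult)
        finally show ?case .
      qed
    qed
    then have "\<forall>\<^sub>F s in at_top. \<forall>i. C * s powr (- \<delta> * \<rho> $ i) \<le> (K * s) powr (- \<delta>' * \<rho> $ i)"
      by (simp add: eventually_all_finite)
    then obtain S where S: "\<And>s i. s \<ge> S \<Longrightarrow> C * s powr (- \<delta> * \<rho> $ i) \<le> (K * s) powr (- \<delta>' * \<rho> $ i)"
      by (auto simp: eventually_at_top_linorder)
    have "\<exists>t\<ge>T. \<exists>x y. (x, y) \<noteq> (0, 0) \<and> dioph_solution \<sigma> \<rho> \<Theta> \<delta>' t x y" for T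
    proof -
      obtain s x y where s: "s \<ge> max 1 (max S T)" and xy: "(x, y) \<noteq> (0, 0)"
        "\<And>j. \<bar>of_int (x $ j)\<bar> \<le> C * s powr (\<sigma> $ j)"
        "\<And>i. \<bar>(\<Theta> *v of_int_vec x) $ i - of_int (y $ i)\<bar> \<le> C * s powr (- \<delta> * \<rho> $ i)"
        using sol[of "max 1 (max S T)"] by blast
      have pos: "K * s > 0"
        using \<open>K \<ge> 1\<close> s by simp
      have "\<bar>of_int (x $ j)\<bar> \<le> (K * s) powr (\<sigma> $ j)" for j
      proof -
        have "C * s powr (\<sigma> $ j) \<le> K powr (\<sigma> $ j) * s powr (\<sigma> $ j)"
          using K[of j] by (rule mult_right_mono) simp
        also have "\<dots> = (K * s) powr (\<sigma> $ j)"
          using \<open>K \<ge> 1\<close> s by (simp add: powr_mult)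
        finally show ?thesis
          using xy(2)[of j] by (rule order_trans[rotated])
      qed
      moreover have "\<bar>(\<Theta> *v of_int_vec x) $ i - of_int (y $ i)\<bar> \<le> (K * s) powr (- \<delta>' * \<rho> $ i)" for i
        using xy(3)[of i] S[of s i] s by simp
      ultimately have "dioph_solution \<sigma> \<rho> \<Theta> \<delta>' (K * s) x y"
        using dioph_solution_iff[OF \<sigma> \<rho> pos] by blast
      moreover have "T \<le> K * s"
      proof -
        have "1 * s \<le> K * s"
          using \<open>K \<ge> 1\<close> s by (intro mult_right_mono) auto
        with s show ?thesis by linarith
      qed
      ultimately show ?thesis
        using xy(1) by blast
    qed
    then show ?thesis
      unfolding weighted_exponent_def by (intro Sup_upper) blast
  qed
  then have "x \<le> weighted_exponent \<sigma> \<rho> \<Theta>" if "x < ereal \<delta>" for x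
    using that by (cases x) simp_all
  then show ?thesis
    by (rule dense_le)
qed

text \<open>
  Dirichlet's theorem: every exponent is at least \<open>1\<close>. As \<open>\<Theta>\<close> is arbitrary, this also covers the exponent
  of \<open>\<Theta>\<close> itself.
\<close>

lemma weighted_exponent_transpose_ge_1:
  fixes \<Theta> :: "real ^ 'm ^ 'n" and \<sigma> :: "real ^ 'm" and \<rho> :: "real ^ 'n"
  assumes \<sigma>: "\<forall>j. \<sigma> $ j > 0" "(\<Sum>j\<in>UNIV. \<sigma> $ j) = 1"
    and \<rho>: "\<forall>i. \<rho> $ i > 0" "(\<Sum>i\<in>UNIV. \<rho> $ i) = 1"
  shows "1 \<le> weighted_exponent \<rho> \<sigma> (transpose \<Theta>)"
proof -
  have "\<exists>s\<ge>T. \<exists>u v. (u, v) \<noteq> (0, 0) \<and>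
      (\<forall>i. \<bar>of_int (u $ i)\<bar> \<le> 2 * s powr (\<rho> $ i)) \<and>
      (\<forall>j. \<bar>(transpose \<Theta> *v of_int_vec u) $ j - of_int (v $ j)\<bar> \<le> 2 * s powr (- 1 * \<sigma> $ j))" for T
  proof -
    define s where "s = max 1 T"
    have s: "s > 0" by (simp add: s_def)
    define b where "b k = 2 * (case k of Inl j \<Rightarrow> s powr (- 1 * \<sigma> $ j) | Inr i \<Rightarrow> s powr (\<rho> $ i))" for k
    have b: "b k > 0" for k
      using s by (simp add: b_def split: sum.split)
    have "(\<Prod>k\<in>UNIV. b k) = 2 ^ CARD('m + 'n) * ((\<Prod>j\<in>UNIV. s powr (- 1 * \<sigma> $ j)) * (\<Prod>i\<in>UNIV. s powr (\<rho> $ i)))"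
      by (simp add: b_def prod.distrib prod_UNIV_Plus power_add)
    also have "\<dots> = 2 ^ CARD('m + 'n) * s powr ((\<Sum>j\<in>UNIV. - 1 * \<sigma> $ j) + (\<Sum>i\<in>UNIV. \<rho> $ i))"
      using s by (simp add: powr_sum powr_add)
    also have "\<dots> = 2 ^ CARD('m + 'n)"
      using s by (simp add: sum_negf \<sigma> \<rho>)
    finally have "(\<Prod>k\<in>UNIV. b k) > 1"
      by (simp del: card_sum)
    then have vol: "\<bar>det (transposed_forms \<Theta>)\<bar> < (\<Prod>k\<in>UNIV. b k)"
      by (simp add: abs_det_transposed_forms)
    have "det (transposed_forms \<Theta>) \<noteq> 0"
      using abs_det_transposed_forms[of \<Theta>] by auto
    from minkowski_linear_forms[OF this b vol] obtain p where
      "p \<noteq> 0" "\<And>k. \<bar>(transposed_forms \<Theta> *v of_int_vec p) $ k\<bar> \<le> b k"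
      by (metis less_imp_le)
    from transposed_forms_solution[OF this] show ?thesis
      unfolding b_def by (intro exI[of _ s]) (simp add: s_def)
  qed
  from weighted_exponent_geI[OF \<rho>(1) \<sigma>(1) _ this] show ?thesis
    by (simp add: one_ereal_def)
qed

section \<open>Transference\<close>

text \<open>
  The duality principle for the two systems: \<open>\<alpha>\<close> bounds the values \<open>\<Theta>\<^sup>T u - v\<close> and \<open>\<beta>\<close> bounds \<open>u\<close>.
\<close>

lemma box_transference:
  fixes \<Theta> :: "real ^ 'm ^ 'n" and x :: "int ^ 'm" and y :: "int ^ 'n"
    and \<alpha> :: "'m \<Rightarrow> real" and \<beta> :: "'n \<Rightarrow> real"
  assumes "(x, y) \<noteq> (0, 0)" and \<alpha>: "\<And>j. \<alpha> j > 0" and \<beta>: "\<And>i. \<beta> i > 0"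
    and x: "\<And>j. \<bar>of_int (x $ j)\<bar> * \<alpha> j \<le> (\<Prod>j\<in>UNIV. \<alpha> j) * (\<Prod>i\<in>UNIV. \<beta> i)"
    and y: "\<And>i. \<bar>(\<Theta> *v of_int_vec x) $ i - of_int (y $ i)\<bar> * \<beta> i \<le> (\<Prod>j\<in>UNIV. \<alpha> j) * (\<Prod>i\<in>UNIV. \<beta> i)"
  shows "\<exists>u v. (u, v) \<noteq> (0, 0) \<and> (\<forall>i. \<bar>of_int (u $ i)\<bar> \<le> 2 * CARD('m + 'n) * \<beta> i) \<and>
    (\<forall>j. \<bar>(transpose \<Theta> *v of_int_vec u) $ j - of_int (v $ j)\<bar> \<le> 2 * CARD('m + 'n) * \<alpha> j)"
proof -
  define \<zeta> :: "real ^ ('m + 'n)" where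
    "\<zeta> = (\<chi> k. case k of Inl j \<Rightarrow> of_int_vec x $ j | Inr i \<Rightarrow> (of_int_vec y - \<Theta> *v of_int_vec x) $ i)"
  define \<tau> where "\<tau> k = (case k of Inl j \<Rightarrow> \<alpha> j | Inr i \<Rightarrow> \<beta> i)" for k
  have "CARD('m) > 0" "CARD('n) > 0"
    by simp_all
  then have d: "CARD('m + 'n) \<ge> 2"
    unfolding card_sum by linarith
  have "\<zeta> \<noteq> 0"
  proof
    assume "\<zeta> = 0"
    then have *: "\<zeta> $ k = 0" for k by simp
    have "x $ j = 0" for j
      using *[of "Inl j"] by (simp add: \<zeta>_def)
    then have "x = 0"
      by (simp add: vec_eq_iff)
    moreover have "y $ i = 0" for i
    proof -
      have "of_int_vec x = (0 :: real ^ 'm)"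
        by (simp add: \<open>x = 0\<close> vec_eq_iff)
      then show ?thesis
        using *[of "Inr i"] by (simp add: \<zeta>_def)
    qed
    ultimately show False
      using assms(1) by (simp add: vec_eq_iff)
  qed
  moreover have "\<zeta> \<bullet> (transposed_forms \<Theta> *v of_int_vec p) \<in> \<int>" for p
    unfolding \<zeta>_def by (rule transposed_forms_integer_pairing)
  moreover have "\<tau> k > 0" for k
    using \<alpha> \<beta> by (simp add: \<tau>_def split: sum.split)
  moreover have "\<bar>\<zeta> $ k\<bar> * \<tau> k \<le> (\<Prod>k\<in>UNIV. \<tau> k)" for k
  proof -
    have "(\<Prod>k\<in>UNIV. \<tau> k) = (\<Prod>j\<in>UNIV. \<alpha> j) * (\<Prod>i\<in>UNIV. \<beta> i)"
      by (simp add: prod_UNIV_Plus \<tau>_def)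
    then show ?thesis
      using x y by (cases k) (simp_all add: \<zeta>_def \<tau>_def abs_minus_commute)
  qed
  ultimately obtain p where
    "p \<noteq> 0" "\<And>k. \<bar>(transposed_forms \<Theta> *v of_int_vec p) $ k\<bar> \<le> 2 * CARD('m + 'n) * \<tau> k"
    using mahler_duality[OF abs_det_transposed_forms d] by blast
  from transposed_forms_solution[OF this] show ?thesis
    by (simp add: \<tau>_def)
qed

text \<open>
  In the proof, \<open>\<delta>\<close> is the asserted bound and \<open>S = t\<^sup>a\<close>. The values of \<open>a\<close> and \<open>\<delta>\<close> are the solution of
  \<open>a (\<delta> - 1) = (a \<delta> - 1) s = (\<gamma> - a) r\<close>; the common value of the three terms is \<open>q\<close>.
\<close>

lemma exponent_transference:
  fixes \<Theta> :: "real ^ 'm ^ 'n" and \<sigma> :: "real ^ 'm" and \<rho> :: "real ^ 'n"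
  assumes \<sigma>: "(\<Sum>j\<in>UNIV. \<sigma> $ j) = 1" and s: "0 < s" "s \<le> 1" "\<And>j. s \<le> \<sigma> $ j"
    and \<rho>: "(\<Sum>i\<in>UNIV. \<rho> $ i) = 1" and r: "0 < r" "r \<le> 1" "\<And>i. r \<le> \<rho> $ i"
    and \<gamma>: "\<gamma> \<ge> 1"
    and sol: "\<And>T. \<exists>t\<ge>T. \<exists>x y. (x, y) \<noteq> (0, 0) \<and> dioph_solution \<sigma> \<rho> \<Theta> \<gamma> t x y"
  shows "ereal (((inverse r - 1) + inverse s * \<gamma>) / (inverse r + (inverse s - 1) * \<gamma>))
    \<le> weighted_exponent \<rho> \<sigma> (transpose \<Theta>)"
proof -
  have \<sigma>_pos: "\<forall>j. \<sigma> $ j > 0" and \<rho>_pos: "\<forall>i. \<rho> $ i > 0"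
    using s r by (meson less_le_trans)+
  define D where "D = inverse r + (inverse s - 1) * \<gamma>"
  define E where "E = inverse r + inverse s - 1"
  define \<delta> where "\<delta> = ((inverse r - 1) + inverse s * \<gamma>) / D"
  define a where "a = D / E"
  have inv: "inverse r \<ge> 1" "inverse s \<ge> 1"
    using r s by (simp_all add: one_le_inverse_iff)
  have DE: "D > 0" "E > 0"
  proof -
    show "D > 0"
      unfolding D_def using inv \<gamma> by (intro add_pos_nonneg mult_nonneg_nonneg) linarith+
    show "E > 0"
      unfolding E_def using inv by linarith
  qed
  then have a: "a > 0" by (simp add: a_def)
  have a\<delta>: "a * \<delta> = ((inverse r - 1) + inverse s * \<gamma>) / E"
    using DE by (simp add: a_def \<delta>_def)
  define q where "q = (\<gamma> - 1) / E"
  have q: "q \<ge> 0"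
    using \<gamma> DE by (simp add: q_def)
  have e1: "a * (1 - \<delta>) = - q"
  proof -
    have "a * (1 - \<delta>) = a - a * \<delta>"
      by (simp add: right_diff_distrib)
    also have "\<dots> = (D - ((inverse r - 1) + inverse s * \<gamma>)) / E"
      unfolding a\<delta> unfolding a_def by (simp add: diff_divide_distrib)
    also have "D - ((inverse r - 1) + inverse s * \<gamma>) = - (\<gamma> - 1)"
      by (simp add: D_def left_diff_distrib)
    finally show ?thesis
      by (simp only: q_def minus_divide_left)
  qed
  have e2: "a * \<delta> - 1 = q * inverse s"
  proof -
    have "a * \<delta> - 1 = ((inverse r - 1) + inverse s * \<gamma> - E) / E"
      using DE(2) by (simp add: a\<delta> diff_divide_distrib)
    also have "(inverse r - 1) + inverse s * \<gamma> - E = (\<gamma> - 1) * inverse s"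
      by (simp add: E_def algebra_simps)
    finally show ?thesis by (simp only: q_def times_divide_eq_left)
  qed
  have e3: "\<gamma> - a = q * inverse r"
  proof -
    have "\<gamma> - a = (\<gamma> * E - D) / E"
      using DE(2) by (simp add: a_def diff_divide_distrib)
    also have "\<gamma> * E - D = (\<gamma> - 1) * inverse r"
      by (simp add: D_def E_def algebra_simps)
    finally show ?thesis by (simp only: q_def times_divide_eq_left)
  qed
  have exp_x: "\<sigma> $ j + a * (- \<delta> * \<sigma> $ j) \<le> a * (1 - \<delta>)" for j
  proof -
    have "1 \<le> inverse s * \<sigma> $ j"
      using s(1) s(3)[of j] by (simp add: field_simps)
    then have "q * 1 \<le> q * (inverse s * \<sigma> $ j)"
      using q by (rule mult_left_mono)
    also have "\<dots> = (a * \<delta> - 1) * \<sigma> $ j"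
      by (simp only: e2 mult.assoc)
    also have "\<dots> = - (\<sigma> $ j + a * (- \<delta> * \<sigma> $ j))"
      by (simp add: left_diff_distrib)
    finally show ?thesis
      unfolding e1 by linarith
  qed
  have exp_y: "- \<gamma> * \<rho> $ i + a * \<rho> $ i \<le> a * (1 - \<delta>)" for i
  proof -
    have "1 \<le> inverse r * \<rho> $ i"
      using r(1) r(3)[of i] by (simp add: field_simps)
    then have "q * 1 \<le> q * (inverse r * \<rho> $ i)"
      using q by (rule mult_left_mono)
    also have "\<dots> = (\<gamma> - a) * \<rho> $ i"
      by (simp only: e3 mult.assoc)
    also have "\<dots> = - (- \<gamma> * \<rho> $ i + a * \<rho> $ i)"
      by (simp add: left_diff_distrib)
    finally show ?thesis
      unfolding e1 by linarith
  qed
  let ?C = "real (2 * CARD('m + 'n))"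
  have "\<exists>S\<ge>T. \<exists>u v. (u, v) \<noteq> (0, 0) \<and>
      (\<forall>i. \<bar>of_int (u $ i)\<bar> \<le> ?C * S powr (\<rho> $ i)) \<and>
      (\<forall>j. \<bar>(transpose \<Theta> *v of_int_vec u) $ j - of_int (v $ j)\<bar> \<le> ?C * S powr (- \<delta> * \<sigma> $ j))" for T
  proof -
    obtain t0 where t0: "\<And>t. t \<ge> t0 \<Longrightarrow> T \<le> t powr a"
      using filterlim_powr_at_top[OF a] unfolding filterlim_at_top eventually_at_top_linorder by blast
    obtain t x y where t: "t \<ge> max 1 t0" and xy: "(x, y) \<noteq> (0, 0)" "dioph_solution \<sigma> \<rho> \<Theta> \<gamma> t x y"
      using sol[of "max 1 t0"] by blast
    have t_ge: "t \<ge> 1" "t > 0" using t by auto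
    define S where "S = t powr a"
    have S_powr: "S powr c = t powr (a * c)" for c
      by (simp add: S_def powr_powr)
    have "S \<noteq> 0"
      using t_ge by (simp add: S_def)
    have sols: "\<bar>of_int (x $ j)\<bar> \<le> t powr (\<sigma> $ j)"
        "\<bar>(\<Theta> *v of_int_vec x) $ i - of_int (y $ i)\<bar> \<le> t powr (- \<gamma> * \<rho> $ i)" for i j
      using xy(2) dioph_solution_iff[OF \<sigma>_pos \<rho>_pos t_ge(2)] by blast+
    have "(\<Prod>j\<in>UNIV. S powr (- \<delta> * \<sigma> $ j)) * (\<Prod>i\<in>UNIV. S powr (\<rho> $ i)) = S powr (1 - \<delta>)"
    proof -
      have "(\<Prod>j\<in>UNIV. S powr (- \<delta> * \<sigma> $ j)) = S powr (- \<delta>)"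
        using \<open>S \<noteq> 0\<close> \<sigma> by (simp add: powr_sum[symmetric] sum_negf flip: sum_distrib_left)
      moreover have "(\<Prod>i\<in>UNIV. S powr (\<rho> $ i)) = S powr 1"
        using \<open>S \<noteq> 0\<close> \<rho> by (simp add: powr_sum[symmetric])
      ultimately show ?thesis
        by (simp only: powr_add[symmetric]) simp
    qed
    then have prod: "(\<Prod>j\<in>UNIV. S powr (- \<delta> * \<sigma> $ j)) * (\<Prod>i\<in>UNIV. S powr (\<rho> $ i)) = t powr (a * (1 - \<delta>))"
      by (simp only: S_powr)
    have "\<bar>of_int (x $ j)\<bar> * S powr (- \<delta> * \<sigma> $ j) \<le> t powr (a * (1 - \<delta>))" for j
    proof -
      have "\<bar>of_int (x $ j)\<bar> * S powr (- \<delta> * \<sigma> $ j) \<le> t powr (\<sigma> $ j) * S powr (- \<delta> * \<sigma> $ j)"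
        by (intro mult_right_mono sols) simp
      also have "\<dots> = t powr (\<sigma> $ j + a * (- \<delta> * \<sigma> $ j))"
        by (simp only: S_powr powr_add)
      also have "\<dots> \<le> t powr (a * (1 - \<delta>))"
        by (rule powr_mono[OF exp_x t_ge(1)])
      finally show ?thesis .
    qed
    moreover have "\<bar>(\<Theta> *v of_int_vec x) $ i - of_int (y $ i)\<bar> * S powr (\<rho> $ i) \<le> t powr (a * (1 - \<delta>))" for i
    proof -
      have "\<bar>(\<Theta> *v of_int_vec x) $ i - of_int (y $ i)\<bar> * S powr (\<rho> $ i) \<le> t powr (- \<gamma> * \<rho> $ i) * S powr (\<rho> $ i)"
        by (intro mult_right_mono sols) simp
      also have "\<dots> = t powr (- \<gamma> * \<rho> $ i + a * \<rho> $ i)"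
        by (simp only: S_powr powr_add)
      also have "\<dots> \<le> t powr (a * (1 - \<delta>))"
        by (rule powr_mono[OF exp_y t_ge(1)])
      finally show ?thesis .
    qed
    ultimately have "\<exists>u v. (u, v) \<noteq> (0, 0) \<and> (\<forall>i. \<bar>of_int (u $ i)\<bar> \<le> ?C * S powr (\<rho> $ i)) \<and>
      (\<forall>j. \<bar>(transpose \<Theta> *v of_int_vec u) $ j - of_int (v $ j)\<bar> \<le> ?C * S powr (- \<delta> * \<sigma> $ j))"
      using \<open>S \<noteq> 0\<close> by (intro box_transference[OF xy(1)]) (simp_all only: prod, simp_all)
    moreover have "T \<le> S"
      unfolding S_def using t by (intro t0) simp
    ultimately show ?thesis by blast
  qed
  moreover have "?C > 0"
    by (simp add: add_pos_pos)
  ultimately have "ereal \<delta> \<le> weighted_exponent \<rho> \<sigma> (transpose \<Theta>)"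
    by (intro weighted_exponent_geI[OF \<rho>_pos \<sigma>_pos])
  then show ?thesis
    unfolding \<delta>_def D_def .
qed

theorem theorem1:
  fixes \<Theta> :: "real ^ 'm::{finite,linorder} ^ 'n::{finite,linorder}"
    and \<sigma> :: "real ^ 'm::{finite,linorder}" and \<rho> :: "real ^ 'n::{finite,linorder}"
  assumes "CARD('m) + CARD('n) \<ge> 3"
    and "antimono (\<lambda>j. \<sigma> $ j)" and "\<forall>j. \<sigma> $ j > 0" and "(\<Sum>j\<in>UNIV. \<sigma> $ j) = 1"
    and "antimono (\<lambda>i. \<rho> $ i)" and "\<forall>i. \<rho> $ i > 0" and "(\<Sum>i\<in>UNIV. \<rho> $ i) = 1"
  shows "weighted_exponent \<rho> \<sigma> (transpose \<Theta>)
           \<ge> transference_bound (\<sigma> $ Max UNIV) (\<rho> $ Max UNIV) (weighted_exponent \<sigma> \<rho> \<Theta>)"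
proof -
  define s r where "s = \<sigma> $ Max UNIV" and "r = \<rho> $ Max UNIV"
  define \<omega> where "\<omega> = weighted_exponent \<sigma> \<rho> \<Theta>"
  define \<omega>' where "\<omega>' = weighted_exponent \<rho> \<sigma> (transpose \<Theta>)"
  define f where "f \<gamma> = ((inverse r - 1) + inverse s * \<gamma>) / (inverse r + (inverse s - 1) * \<gamma>)" for \<gamma>
  have s: "0 < s" "s \<le> 1" "\<And>j. s \<le> \<sigma> $ j"
  proof -
    show "0 < s" "\<And>j. s \<le> \<sigma> $ j"
      using assms(3) antimonoD[OF assms(2)] by (auto simp: s_def)
    show "s \<le> 1"
      unfolding s_def assms(4)[symmetric] using assms(3) by (intro member_le_sum) (auto simp: less_imp_le)
  qed
  have r: "0 < r" "r \<le> 1" "\<And>i. r \<le> \<rho> $ i"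
  proof -
    show "0 < r" "\<And>i. r \<le> \<rho> $ i"
      using assms(6) antimonoD[OF assms(5)] by (auto simp: r_def)
    show "r \<le> 1"
      unfolding r_def assms(7)[symmetric] using assms(6) by (intro member_le_sum) (auto simp: less_imp_le)
  qed
  have inv: "inverse r \<ge> 1" "inverse s \<ge> 1"
    using r s by (simp_all add: one_le_inverse_iff)
  have "1 \<le> \<omega>'"
    unfolding \<omega>'_def by (intro weighted_exponent_transpose_ge_1 assms)
  have "1 \<le> \<omega>"
    using weighted_exponent_transpose_ge_1[of \<rho> \<sigma> "transpose \<Theta>"] assms
    by (simp add: \<omega>_def transpose_transpose)
  have below: "ereal (f \<gamma>) \<le> \<omega>'" if "1 \<le> \<gamma>" "ereal \<gamma> < \<omega>" for \<gamma>
    unfolding f_def \<omega>'_def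
    by (rule exponent_transference[OF assms(4) s assms(7) r that(1)
          solutions_below_weighted_exponent[OF that(2)[unfolded \<omega>_def]]])
  have "transference_bound s r \<omega> \<le> \<omega>'"
  proof (cases \<omega>)
    case (real w)
    have bound: "transference_bound s r \<omega> = ereal (f w)"
      by (simp add: transference_bound_def f_def real)
    consider "w = 1" | "w > 1"
      using \<open>1 \<le> \<omega>\<close> real by fastforce
    then show ?thesis
    proof cases
      case 1
      then have "f w = 1"
        using inv by (simp add: f_def)
      with bound \<open>1 \<le> \<omega>'\<close> show ?thesis by (simp add: one_ereal_def)
    next
      case 2
      then have "inverse r + (inverse s - 1) * w > 0"
        using inv by (intro add_pos_nonneg mult_nonneg_nonneg) linarith+
      then have "(f \<longlongrightarrow> f w) (at_left w)"
        unfolding f_def by (intro tendsto_intros) auto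
      then have "((\<lambda>\<gamma>. ereal (f \<gamma>)) \<longlongrightarrow> ereal (f w)) (at_left w)"
        by simp
      moreover have "\<forall>\<^sub>F \<gamma> in at_left w. ereal (f \<gamma>) \<le> \<omega>'"
        using eventually_at_left_real[OF 2] by eventually_elim (auto intro!: below simp: real)
      ultimately show ?thesis
        unfolding bound by (rule tendsto_upperbound) simp
    qed
  next
    case PInf
    have ev: "\<forall>\<^sub>F \<gamma> in at_top. ereal (f \<gamma>) \<le> \<omega>'"
      using eventually_ge_at_top[of 1] by eventually_elim (auto intro!: below simp: PInf)
    show ?thesis
    proof (cases "s = 1")
      case True
      have "filterlim f at_top at_top"
        unfolding f_def using True r by (simp, real_asymp)
      then have "((\<lambda>\<gamma>. ereal (f \<gamma>)) \<longlongrightarrow> \<infinity>) at_top"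
        by (simp add: tendsto_PInfty_eq_at_top)
      from tendsto_upperbound[OF this ev] show ?thesis
        by (simp add: transference_bound_def PInf True)
    next
      case False
      then have "s < 1"
        using s by auto
      have "(f \<longlongrightarrow> inverse s * inverse (inverse s - 1)) at_top"
        unfolding f_def using \<open>s < 1\<close> s(1) by real_asymp
      also have "inverse s * inverse (inverse s - 1) = inverse (1 - s)"
        using \<open>s < 1\<close> s(1) by (simp add: field_simps)
      finally have "(f \<longlongrightarrow> inverse (1 - s)) at_top" .
      then have "((\<lambda>\<gamma>. ereal (f \<gamma>)) \<longlongrightarrow> ereal (inverse (1 - s))) at_top"
        by simp
      from tendsto_upperbound[OF this ev] show ?thesis
        using False by (simp add: transference_bound_def PInf)
    qed
  next
    case MInf
    with \<open>1 \<le> \<omega>\<close> show ?thesis by simp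
  qed
  then show ?thesis
    by (simp add: s_def r_def \<omega>_def \<omega>'_def)
qed

end
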